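(* Let $G=\langle V,E,L\rangle$ and $G'=\langle V',E',L'\rangle$ be finite fuzzy graphs. Algorithm B (described in the context), run on $G$ and $G'$ with any choices of iteration orders and of the pairs extracted from $R$, always terminates and returns the largest directed simulation between $G$ and $G'$.
   Context: A fuzzy graph over finite sets $\Sigma_V,\Sigma_E$ is $G=\langle V,E,L\rangle$ with $E: V\times\Sigma_E\times V\to[0,1]$, $L: V\to(\Sigma_V\to[0,1])$; $f\le g$ for $f,g:\Sigma_V\to[0,1]$ means pointwise. $Z\subseteq V\times V'$ (possibly empty) is a directed simulation between $G$ and $G'=\langle V',E',L'\rangle$ if for all $x,y\in V$, $x',y'\in V'$, $r\in\Sigma_E$: $(x,x')\in Z$ implies $L(x)\le L'(x')$; $(x,x')\in Z$ and $E(x,r,y)>0$ imply there is $y'\in V'$ with $(y,y')\in Z$ and $E(x,r,y)\le E'(x',r,y')$; $(x,x')\in Z$ and $E'(x',r,y')>0$ imply there is $y\in V$ with $(y,y')\in Z$ and $E'(x',r,y')\le E(x,r,y)$. The largest directed simulation is the union of all directed simulations. Notation: $\mathrm{Next}_r(x)=\{y\in V:E(x,r,y)>0\}$, $\mathrm{Prev}_r(y)=\{x\in V: E(x,r,y)>0\}$, $\mathrm{Next}'_r(x')=\{y'\in V':E'(x',r,y')>0\}$, $\mathrm{Prev}'_r(y')=\{x'\in V':E'(x',r,y')>0\}$; suprema in $[0,1]$, $\sup\emptyset=0$. Algorithm B maintains $Z,R\subseteq V\times V'$. ProcessPrev$(r,y,x')$: let $d=\sup\{E'(x',r,y')\mid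 y'\in\mathrm{Next}'_r(x'),(y,y')\in Z\cup R\}$; for each $x\in\mathrm{Prev}_r(y)$, if $E(x,r,y)>d$ and $(x,x')\in Z$, move $(x,x')$ from $Z$ to $R$. ProcessPrev$'(r,x,y')$: let $d=\sup\{E(x,r,y)\mid y\in\mathrm{Next}_r(x),(y,y')\in Z\cup R\}$; for each $x'\in\mathrm{Prev}'_r(y')$, if $E'(x',r,y')>d$ and $(x,x')\in Z$, move $(x,x')$ from $Z$ to $R$. Algorithm B: $Z:=\{(x,x')\mid L(x)\le L'(x')\}$, $R:=\emptyset$; for each $(r,y,x')\in\Sigma_E\times V\times V'$ call ProcessPrev$(r,y,x')$; for each $(r,x,y')\in\Sigma_E\times V\times V'$ call ProcessPrev$'(r,x,y')$; while $R\ne\emptyset$: remove some pair $(y,y')$ from $R$, for each $r\in\Sigma_E$ and $x'\in\mathrm{Prev}'_r(y')$ call ProcessPrev$(r,y,x')$, and for each $r\in\Sigma_E$ and $x\in\mathrm{Prev}_r(y)$ call ProcessPrev$'(r,x,y')$; return $Z$. *)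

theory Defs
  imports Complex_Main
begin

record ('v, 'r, 'a) fuzzy_graph =
  verts :: "'v set"
  edge :: "'v \<Rightarrow> 'r \<Rightarrow> 'v \<Rightarrow> real"
  label :: "'v \<Rightarrow> 'a \<Rightarrow> real"

text \<open>
  The values of \<open>edge\<close> and \<open>label\<close> outside the vertex set and the alphabets are unconstrained;
  all definitions below only refer to arguments inside these sets.
\<close>

definition is_fuzzy_graph :: "'a set \<Rightarrow> 'r set \<Rightarrow> ('v, 'r, 'a) fuzzy_graph \<Rightarrow> bool" where
  "is_fuzzy_graph \<Sigma>V \<Sigma>E G \<longleftrightarrow>
     finite \<Sigma>V \<and> finite \<Sigma>E \<and>
     (\<forall>x\<in>verts G. \<forall>r\<in>\<Sigma>E. \<forall>y\<in>verts G. edge G x r y \<in> {0..1}) \<and>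
     (\<forall>x\<in>verts G. \<forall>a\<in>\<Sigma>V. label G x a \<in> {0..1})"

definition finite_fuzzy_graph :: "'a set \<Rightarrow> 'r set \<Rightarrow> ('v, 'r, 'a) fuzzy_graph \<Rightarrow> bool" where
  "finite_fuzzy_graph \<Sigma>V \<Sigma>E G \<longleftrightarrow> is_fuzzy_graph \<Sigma>V \<Sigma>E G \<and> finite (verts G)"

definition label_le ::
  "'a set \<Rightarrow> ('v, 'r, 'a) fuzzy_graph \<Rightarrow> ('w, 'r, 'a) fuzzy_graph \<Rightarrow> 'v \<Rightarrow> 'w \<Rightarrow> bool" where
  "label_le \<Sigma>V G G' x x' \<longleftrightarrow> (\<forall>a\<in>\<Sigma>V. label G x a \<le> label G' x' a)"

definition directed_simulation ::
  "'a set \<Rightarrow> 'r set \<Rightarrow> ('v, 'r, 'a) fuzzy_graph \<Rightarrow> ('w, 'r, 'a) fuzzy_graph \<Rightarrow> ('v \<times> 'w) set \<Rightarrow> bool"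
where
  "directed_simulation \<Sigma>V \<Sigma>E G G' Z \<longleftrightarrow>
     Z \<subseteq> verts G \<times> verts G' \<and>
     (\<forall>x\<in>verts G. \<forall>x'\<in>verts G'. (x, x') \<in> Z \<longrightarrow> label_le \<Sigma>V G G' x x') \<and>
     (\<forall>x\<in>verts G. \<forall>y\<in>verts G. \<forall>x'\<in>verts G'. \<forall>r\<in>\<Sigma>E. (x, x') \<in> Z \<and> edge G x r y > 0 \<longrightarrow>
        (\<exists>y'\<in>verts G'. (y, y') \<in> Z \<and> edge G x r y \<le> edge G' x' r y')) \<and>
     (\<forall>x\<in>verts G. \<forall>x'\<in>verts G'. \<forall>y'\<in>verts G'. \<forall>r\<in>\<Sigma>E. (x, x') \<in> Z \<and> edge G' x' r y' > 0 \<longrightarrow>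
        (\<exists>y\<in>verts G. (y, y') \<in> Z \<and> edge G' x' r y' \<le> edge G x r y))"

definition largest_directed_simulation ::
  "'a set \<Rightarrow> 'r set \<Rightarrow> ('v, 'r, 'a) fuzzy_graph \<Rightarrow> ('w, 'r, 'a) fuzzy_graph \<Rightarrow> ('v \<times> 'w) set" where
  "largest_directed_simulation \<Sigma>V \<Sigma>E G G' = \<Union> {Z. directed_simulation \<Sigma>V \<Sigma>E G G' Z}"

lemma directed_simulation_largest:
  "directed_simulation \<Sigma>V \<Sigma>E G G' (largest_directed_simulation \<Sigma>V \<Sigma>E G G')"
  unfolding largest_directed_simulation_def directed_simulation_def
  by (intro conjI ballI impI) (blast | meson UnionE UnionI mem_Collect_eq)+

definition Next :: "('v, 'r, 'a) fuzzy_graph \<Rightarrow> 'r \<Rightarrow> 'v \<Rightarrow> 'v set" where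
  "Next G r x = {y \<in> verts G. edge G x r y > 0}"

definition Prev :: "('v, 'r, 'a) fuzzy_graph \<Rightarrow> 'r \<Rightarrow> 'v \<Rightarrow> 'v set" where
  "Prev G r y = {x \<in> verts G. edge G x r y > 0}"

text \<open>Supremum in \<open>[0,1]\<close>; on \<^typ>\<open>real\<close> the value of \<open>Sup {}\<close> is unspecified.\<close>

definition sup01 :: "real set \<Rightarrow> real" where
  "sup01 X = (if X = {} then 0 else Sup X)"

definition bound_fwd ::
  "('w, 'r, 'a) fuzzy_graph \<Rightarrow> ('v \<times> 'w) set \<Rightarrow> ('v \<times> 'w) set \<Rightarrow> 'r \<Rightarrow> 'v \<Rightarrow> 'w \<Rightarrow> real" where
  "bound_fwd G' Z R r y x' = sup01 {edge G' x' r y' | y'. y' \<in> Next G' r x' \<and> (y, y') \<in> Z \<union> R}"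

definition bound_bwd ::
  "('v, 'r, 'a) fuzzy_graph \<Rightarrow> ('v \<times> 'w) set \<Rightarrow> ('v \<times> 'w) set \<Rightarrow> 'r \<Rightarrow> 'v \<Rightarrow> 'w \<Rightarrow> real" where
  "bound_bwd G Z R r x y' = sup01 {edge G x r y | y. y \<in> Next G r x \<and> (y, y') \<in> Z \<union> R}"

text \<open>
  The algorithm is given by a nondeterministic small-step semantics. A configuration
  \<open>(Z, R, K)\<close> consists of the two program variables and the stack \<open>K\<close> of statements still to be
  executed. A for-each loop carries the set of elements not yet visited, and the next element is an
  arbitrary member of it, so that the executions cover all iteration orders.

  \<^item> \<open>ForPP T\<close>: for each \<open>(r, y, x') \<in> T\<close> call ProcessPrev\<open>(r, y, x')\<close>.
  \<^item> \<open>ForPP' T\<close>: for each \<open>(r, x, y') \<in> T\<close> call ProcessPrev\<open>'(r, x, y')\<close>.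
  \<^item> \<open>PPLoop r y x' d S\<close>: the loop over \<open>x \<in> S\<close> in the body of ProcessPrev\<open>(r, y, x')\<close>, with the
    value \<open>d\<close> computed on entry.
  \<^item> \<open>PPLoop' r x y' d S\<close>: the loop over \<open>x' \<in> S\<close> in the body of ProcessPrev\<open>'(r, x, y')\<close>, with the
    value \<open>d\<close> computed on entry.
  \<^item> \<open>WhileR\<close>: the main loop, while \<open>R \<noteq> {}\<close>.
\<close>

datatype ('v, 'w, 'r) stmt =
    ForPP "('r \<times> 'v \<times> 'w) set"
  | ForPP' "('r \<times> 'v \<times> 'w) set"
  | PPLoop 'r 'v 'w real "'v set"
  | PPLoop' 'r 'v 'w real "'w set"
  | WhileR

type_synonym ('v, 'w, 'r) config =
  "('v \<times> 'w) set \<times> ('v \<times> 'w) set \<times> ('v, 'w, 'r) stmt list"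

inductive stepB ::
  "'r set \<Rightarrow> ('v, 'r, 'a) fuzzy_graph \<Rightarrow> ('w, 'r, 'a) fuzzy_graph \<Rightarrow>
   ('v, 'w, 'r) config \<Rightarrow> ('v, 'w, 'r) config \<Rightarrow> bool"
  for \<Sigma>E :: "'r set" and G :: "('v, 'r, 'a) fuzzy_graph" and G' :: "('w, 'r, 'a) fuzzy_graph"
where
  ForPP_done: "stepB \<Sigma>E G G' (Z, R, ForPP {} # K) (Z, R, K)"
| ForPP_call: "(r, y, x') \<in> T \<Longrightarrow>
    stepB \<Sigma>E G G' (Z, R, ForPP T # K)
      (Z, R, PPLoop r y x' (bound_fwd G' Z R r y x') (Prev G r y) # ForPP (T - {(r, y, x')}) # K)"
| ForPP'_done: "stepB \<Sigma>E G G' (Z, R, ForPP' {} # K) (Z, R, K)"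
| ForPP'_call: "(r, x, y') \<in> T \<Longrightarrow>
    stepB \<Sigma>E G G' (Z, R, ForPP' T # K)
      (Z, R, PPLoop' r x y' (bound_bwd G Z R r x y') (Prev G' r y') # ForPP' (T - {(r, x, y')}) # K)"
| PPLoop_done: "stepB \<Sigma>E G G' (Z, R, PPLoop r y x' d {} # K) (Z, R, K)"
| PPLoop_move: "x \<in> S \<Longrightarrow> edge G x r y > d \<and> (x, x') \<in> Z \<Longrightarrow>
    stepB \<Sigma>E G G' (Z, R, PPLoop r y x' d S # K)
      (Z - {(x, x')}, insert (x, x') R, PPLoop r y x' d (S - {x}) # K)"
| PPLoop_skip: "x \<in> S \<Longrightarrow> \<not> (edge G x r y > d \<and> (x, x') \<in> Z) \<Longrightarrow>
    stepB \<Sigma>E G G' (Z, R, PPLoop r y x' d S # K) (Z, R, PPLoop r y x' d (S - {x}) # K)"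
| PPLoop'_done: "stepB \<Sigma>E G G' (Z, R, PPLoop' r x y' d {} # K) (Z, R, K)"
| PPLoop'_move: "x' \<in> S \<Longrightarrow> edge G' x' r y' > d \<and> (x, x') \<in> Z \<Longrightarrow>
    stepB \<Sigma>E G G' (Z, R, PPLoop' r x y' d S # K)
      (Z - {(x, x')}, insert (x, x') R, PPLoop' r x y' d (S - {x'}) # K)"
| PPLoop'_skip: "x' \<in> S \<Longrightarrow> \<not> (edge G' x' r y' > d \<and> (x, x') \<in> Z) \<Longrightarrow>
    stepB \<Sigma>E G G' (Z, R, PPLoop' r x y' d S # K) (Z, R, PPLoop' r x y' d (S - {x'}) # K)"
| WhileR_done: "stepB \<Sigma>E G G' (Z, {}, WhileR # K) (Z, {}, K)"
| WhileR_iter: "(y, y') \<in> R \<Longrightarrow>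
    stepB \<Sigma>E G G' (Z, R, WhileR # K)
      (Z, R - {(y, y')},
       ForPP {(r, y, x') | r x'. r \<in> \<Sigma>E \<and> x' \<in> Prev G' r y'} #
       ForPP' {(r, x, y') | r x. r \<in> \<Sigma>E \<and> x \<in> Prev G r y} # WhileR # K)"

definition initB ::
  "'a set \<Rightarrow> 'r set \<Rightarrow> ('v, 'r, 'a) fuzzy_graph \<Rightarrow> ('w, 'r, 'a) fuzzy_graph \<Rightarrow> ('v, 'w, 'r) config" where
  "initB \<Sigma>V \<Sigma>E G G' =
     ({(x, x'). x \<in> verts G \<and> x' \<in> verts G' \<and> label_le \<Sigma>V G G' x x'}, {},
      [ForPP (\<Sigma>E \<times> verts G \<times> verts G'), ForPP' (\<Sigma>E \<times> verts G \<times> verts G'), WhileR])"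

definition reachableB ::
  "'a set \<Rightarrow> 'r set \<Rightarrow> ('v, 'r, 'a) fuzzy_graph \<Rightarrow> ('w, 'r, 'a) fuzzy_graph \<Rightarrow>
   ('v, 'w, 'r) config \<Rightarrow> bool" where
  "reachableB \<Sigma>V \<Sigma>E G G' = (stepB \<Sigma>E G G')\<^sup>*\<^sup>* (initB \<Sigma>V \<Sigma>E G G')"

end

theory Submission
  imports Defs
begin

text \<open>
  Both transfer conditions of a directed simulation are constraints \<open>(p, W)\<close>: if \<open>p\<close> is in the
  relation, then so is some member of \<open>W\<close>. The algorithm prunes \<open>Z\<close> by the pairs whose constraints
  fail. Since a pair leaves \<open>Z\<close> by moving to \<open>R\<close>, the union \<open>U = Z \<union> R\<close> changes only when the main
  loop extracts a pair; hence the threshold \<open>d\<close> computed on entry of a call decides, throughout the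
  call, which of the constraints tested there have a witness in \<open>U\<close>. A pair is removed only if
  some constraint on it has no witness in \<open>U \<supseteq> Z\<close>, so no directed simulation contained in \<open>Z\<close> loses
  a pair. Conversely, every constraint on a pair of \<open>Z\<close> either has a witness in \<open>U\<close> or is still to
  be tested by a statement on the stack, because extracting \<open>q\<close> schedules all constraints with
  \<open>q \<in> W\<close>. In the end the stack and \<open>R\<close> are empty, so \<open>Z\<close> satisfies all constraints. Every extraction
  decreases \<open>card U\<close>, and every other step keeps \<open>U\<close> and shortens the work left on the stack.
\<close>

section \<open>Pruning a set by witness constraints\<close>

type_synonym 'p constraint = "'p \<times> 'p set"

definition has_witness :: "'p set \<Rightarrow> 'p constraint \<Rightarrow> bool" where
  "has_witness U c \<longleftrightarrow> snd c \<inter> U \<noteq> {}"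

definition consistent :: "'p constraint set \<Rightarrow> 'p set \<Rightarrow> bool" where
  "consistent C Z \<longleftrightarrow> (\<forall>c\<in>C. fst c \<in> Z \<longrightarrow> has_witness Z c)"

definition pruning_inv ::
  "'p constraint set \<Rightarrow> 'p set \<Rightarrow> 'p set \<Rightarrow> 'p set \<Rightarrow> 'p constraint set \<Rightarrow> bool" where
  "pruning_inv C S Z R P \<longleftrightarrow>
     S \<subseteq> Z \<and> (\<forall>c\<in>C - P. fst c \<in> Z \<longrightarrow> has_witness (Z \<union> R) c)"

lemma has_witness_mono: "has_witness U c \<Longrightarrow> U \<subseteq> U' \<Longrightarrow> has_witness U' c"
  by (auto simp: has_witness_def)

lemma insert_Diff_Un: "p \<in> Z \<Longrightarrow> insert p (Z - {p} \<union> R) = Z \<union> R"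
  by auto

lemma pruning_inv_move:
  assumes inv: "pruning_inv C S Z R P" and "consistent C S"
    and failing: "c \<in> C" "fst c = p" "\<not> has_witness (Z \<union> R) c"
    and "p \<in> Z" and "P \<subseteq> insert c P'"
  shows "pruning_inv C S (Z - {p}) (insert p R) P'"
proof -
  have "\<not> has_witness S c"
    using inv failing(3) has_witness_mono[of S c "Z \<union> R"] by (auto simp: pruning_inv_def)
  then have "p \<notin> S"
    using \<open>consistent C S\<close> failing(1,2) by (auto simp: consistent_def)
  then show ?thesis
    using inv failing(2) \<open>p \<in> Z\<close> \<open>P \<subseteq> insert c P'\<close>
    by (auto simp: pruning_inv_def insert_Diff_Un)
qed

lemma pruning_inv_discharge:
  assumes "pruning_inv C S Z R P" and "fst c \<in> Z \<longrightarrow> has_witness (Z \<union> R) c" and "P \<subseteq> insert c P'"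
  shows "pruning_inv C S Z R P'"
  using assms by (auto simp: pruning_inv_def)

lemma pruning_inv_extract:
  assumes "pruning_inv C S Z R P" and "P \<union> {c \<in> C. q \<in> snd c} \<subseteq> P'"
  shows "pruning_inv C S Z (R - {q}) P'"
proof -
  have "has_witness (Z \<union> (R - {q})) c" if "c \<in> C - P'" "fst c \<in> Z" for c
  proof -
    have "c \<notin> P" and "q \<notin> snd c"
      using that(1) assms(2) by auto
    moreover from this that have "has_witness (Z \<union> R) c"
      using assms(1) by (simp add: pruning_inv_def)
    ultimately show ?thesis
      by (auto simp: has_witness_def)
  qed
  then show ?thesis
    using assms(1) by (auto simp: pruning_inv_def)
qed

lemma pruning_inv_consistent: "pruning_inv C S Z {} {} \<Longrightarrow> consistent C Z"
  by (simp add: pruning_inv_def consistent_def)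

section \<open>Directed simulations as consistent sets\<close>

lemma le_sup01_image_iff:
  assumes "finite A" and "0 < e"
  shows "e \<le> sup01 (f ` A) \<longleftrightarrow> (\<exists>a\<in>A. e \<le> f a)"
proof (cases "A = {}")
  case False
  with \<open>finite A\<close> have "sup01 (f ` A) = Max (f ` A)"
    by (simp add: sup01_def cSup_eq_Max)
  with False \<open>finite A\<close> show ?thesis
    by (simp add: Max_ge_iff)
qed (use \<open>0 < e\<close> in \<open>simp add: sup01_def\<close>)

locale finite_fuzzy_graph_pair =
  fixes \<Sigma>V :: "'a set" and \<Sigma>E :: "'r set"
    and G :: "('v, 'r, 'a) fuzzy_graph" and G' :: "('w, 'r, 'a) fuzzy_graph"
  assumes finite_edge_labels [simp]: "finite \<Sigma>E"
    and finite_verts [simp]: "finite (verts G)" "finite (verts G')"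
begin

definition candidates :: "('v \<times> 'w) set" where
  "candidates = {(x, x'). x \<in> verts G \<and> x' \<in> verts G' \<and> label_le \<Sigma>V G G' x x'}"

definition fwd_constraint :: "'r \<Rightarrow> 'v \<Rightarrow> 'v \<Rightarrow> 'w \<Rightarrow> ('v \<times> 'w) constraint" where
  "fwd_constraint r x y x' = ((x, x'), {y} \<times> {y' \<in> verts G'. edge G x r y \<le> edge G' x' r y'})"

definition bwd_constraint :: "'r \<Rightarrow> 'v \<Rightarrow> 'w \<Rightarrow> 'w \<Rightarrow> ('v \<times> 'w) constraint" where
  "bwd_constraint r x x' y' = ((x, x'), {y \<in> verts G. edge G' x' r y' \<le> edge G x r y} \<times> {y'})"

definition fwd_constraints :: "('r \<times> 'v \<times> 'w) set \<Rightarrow> ('v \<times> 'w) constraint set" where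
  "fwd_constraints T = (\<Union>(r, y, x')\<in>T. (\<lambda>x. fwd_constraint r x y x') ` Prev G r y)"

definition bwd_constraints :: "('r \<times> 'v \<times> 'w) set \<Rightarrow> ('v \<times> 'w) constraint set" where
  "bwd_constraints T = (\<Union>(r, x, y')\<in>T. (\<lambda>x'. bwd_constraint r x x' y') ` Prev G' r y')"

definition constraints :: "('v \<times> 'w) constraint set" where
  "constraints =
     fwd_constraints (\<Sigma>E \<times> verts G \<times> verts G') \<union> bwd_constraints (\<Sigma>E \<times> verts G \<times> verts G')"

lemma candidates_subset: "candidates \<subseteq> verts G \<times> verts G'"
  by (auto simp: candidates_def)

lemma finite_candidates: "finite candidates"
  using candidates_subset by (rule finite_subset) simp

lemma finite_Prev [simp]: "finite (Prev G r y)" "finite (Prev G' r y')"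
  by (simp_all add: Prev_def)

lemma fwd_constraints_remove:
  assumes "(r, y, x') \<in> T"
  shows "fwd_constraints T =
    (\<lambda>x. fwd_constraint r x y x') ` Prev G r y \<union> fwd_constraints (T - {(r, y, x')})"
  using assms by (auto simp: fwd_constraints_def)

lemma bwd_constraints_remove:
  assumes "(r, x, y') \<in> T"
  shows "bwd_constraints T =
    (\<lambda>x'. bwd_constraint r x x' y') ` Prev G' r y' \<union> bwd_constraints (T - {(r, x, y')})"
  using assms by (auto simp: bwd_constraints_def)

lemma fst_constraint [simp]:
  "fst (fwd_constraint r x y x') = (x, x')" "fst (bwd_constraint r x x' y') = (x, x')"
  by (simp_all add: fwd_constraint_def bwd_constraint_def)

lemma has_witness_fwd_iff:
  "has_witness U (fwd_constraint r x y x') \<longleftrightarrow>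
     (\<exists>y'\<in>verts G'. (y, y') \<in> U \<and> edge G x r y \<le> edge G' x' r y')"
  by (auto simp: has_witness_def fwd_constraint_def)

lemma has_witness_bwd_iff:
  "has_witness U (bwd_constraint r x x' y') \<longleftrightarrow>
     (\<exists>y\<in>verts G. (y, y') \<in> U \<and> edge G' x' r y' \<le> edge G x r y)"
  by (auto simp: has_witness_def bwd_constraint_def)

lemma directed_simulation_iff_consistent:
  "directed_simulation \<Sigma>V \<Sigma>E G G' Z \<longleftrightarrow> Z \<subseteq> candidates \<and> consistent constraints Z"
proof -
  have "consistent constraints Z \<longleftrightarrow>
      (\<forall>r\<in>\<Sigma>E. \<forall>y\<in>verts G. \<forall>x'\<in>verts G'. \<forall>x\<in>Prev G r y.
        (x, x') \<in> Z \<longrightarrow> has_witness Z (fwd_constraint r x y x')) \<and>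
      (\<forall>r\<in>\<Sigma>E. \<forall>x\<in>verts G. \<forall>y'\<in>verts G'. \<forall>x'\<in>Prev G' r y'.
        (x, x') \<in> Z \<longrightarrow> has_witness Z (bwd_constraint r x x' y'))"
    by (simp add: consistent_def constraints_def fwd_constraints_def bwd_constraints_def ball_Un)
  then show ?thesis
    unfolding directed_simulation_def candidates_def has_witness_fwd_iff has_witness_bwd_iff Prev_def
    by blast
qed

lemma edge_le_bound_fwd_iff:
  assumes "x \<in> Prev G r y"
  shows "edge G x r y \<le> bound_fwd G' Z R r y x' \<longleftrightarrow> has_witness (Z \<union> R) (fwd_constraint r x y x')"
proof -
  have "bound_fwd G' Z R r y x' = sup01 (edge G' x' r ` {y' \<in> Next G' r x'. (y, y') \<in> Z \<union> R})"
    by (simp add: bound_fwd_def setcompr_eq_image)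
  with assms show ?thesis
    by (auto simp: le_sup01_image_iff has_witness_fwd_iff Next_def Prev_def)
qed

lemma edge_le_bound_bwd_iff:
  assumes "x' \<in> Prev G' r y'"
  shows "edge G' x' r y' \<le> bound_bwd G Z R r x y' \<longleftrightarrow> has_witness (Z \<union> R) (bwd_constraint r x x' y')"
proof -
  have "bound_bwd G Z R r x y' = sup01 (edge G x r ` {y \<in> Next G r x. (y, y') \<in> Z \<union> R})"
    by (simp add: bound_bwd_def setcompr_eq_image)
  with assms show ?thesis
    by (auto simp: le_sup01_image_iff has_witness_bwd_iff Next_def Prev_def)
qed

section \<open>Well-formed configurations\<close>

fun stmt_ok :: "('v \<times> 'w) set \<Rightarrow> ('v, 'w, 'r) stmt \<Rightarrow> bool" where
  "stmt_ok U (ForPP T) \<longleftrightarrow> T \<subseteq> \<Sigma>E \<times> verts G \<times> verts G'"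
| "stmt_ok U (ForPP' T) \<longleftrightarrow> T \<subseteq> \<Sigma>E \<times> verts G \<times> verts G'"
| "stmt_ok U (PPLoop r y x' d S) \<longleftrightarrow>
     r \<in> \<Sigma>E \<and> y \<in> verts G \<and> x' \<in> verts G' \<and> S \<subseteq> Prev G r y \<and>
     (\<forall>x\<in>S. edge G x r y \<le> d \<longleftrightarrow> has_witness U (fwd_constraint r x y x'))"
| "stmt_ok U (PPLoop' r x y' d S) \<longleftrightarrow>
     r \<in> \<Sigma>E \<and> x \<in> verts G \<and> y' \<in> verts G' \<and> S \<subseteq> Prev G' r y' \<and>
     (\<forall>x'\<in>S. edge G' x' r y' \<le> d \<longleftrightarrow> has_witness U (bwd_constraint r x x' y'))"
| "stmt_ok U WhileR \<longleftrightarrow> True"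

text \<open>
  Pairs are extracted only by \<open>WhileR\<close>; as it occurs only at the bottom of the stack, no call is
  active then and no threshold becomes stale.
\<close>

fun ends_in_WhileR :: "('v, 'w, 'r) stmt list \<Rightarrow> bool" where
  "ends_in_WhileR [] \<longleftrightarrow> False"
| "ends_in_WhileR (WhileR # K) \<longleftrightarrow> K = []"
| "ends_in_WhileR (_ # K) \<longleftrightarrow> ends_in_WhileR K"

definition wf_config :: "('v, 'w, 'r) config \<Rightarrow> bool" where
  "wf_config = (\<lambda>(Z, R, K). Z \<union> R \<subseteq> candidates \<and> Z \<inter> R = {} \<and>
     (\<forall>s\<in>set K. stmt_ok (Z \<union> R) s) \<and> (K = [] \<and> R = {} \<or> ends_in_WhileR K))"

lemma wf_config_initB: "wf_config (initB \<Sigma>V \<Sigma>E G G')"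
  by (auto simp: wf_config_def initB_def candidates_def)

lemma wf_config_stepB:
  assumes "stepB \<Sigma>E G G' c c'" and "wf_config c"
  shows "wf_config c'"
  using assms
proof (induction rule: stepB.induct)
  case (ForPP_call r y x' T Z R K)
  then show ?case
    by (auto simp: wf_config_def edge_le_bound_fwd_iff)
next
  case (ForPP'_call r x y' T Z R K)
  then show ?case
    by (auto simp: wf_config_def edge_le_bound_bwd_iff)
next
  case (WhileR_iter y y' R Z K)
  then show ?case
    using candidates_subset by (auto simp: wf_config_def Prev_def)
qed (auto simp: wf_config_def insert_Diff_Un)

section \<open>Correctness\<close>

fun pending :: "('v, 'w, 'r) stmt \<Rightarrow> ('v \<times> 'w) constraint set" where
  "pending (ForPP T) = fwd_constraints T"
| "pending (ForPP' T) = bwd_constraints T"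
| "pending (PPLoop r y x' d S) = (\<lambda>x. fwd_constraint r x y x') ` S"
| "pending (PPLoop' r x y' d S) = (\<lambda>x'. bwd_constraint r x x' y') ` S"
| "pending WhileR = {}"

definition prunes_towards :: "('v \<times> 'w) set \<Rightarrow> ('v, 'w, 'r) config \<Rightarrow> bool" where
  "prunes_towards S = (\<lambda>(Z, R, K). pruning_inv constraints S Z R (\<Union> (pending ` set K)))"

lemma pending_subset_constraints: "stmt_ok U s \<Longrightarrow> pending s \<subseteq> constraints"
  by (cases s) (fastforce simp: constraints_def fwd_constraints_def bwd_constraints_def)+

lemma constraints_witnessed_by_subset:
  assumes "y \<in> verts G" and "y' \<in> verts G'"
  shows "{c \<in> constraints. (y, y') \<in> snd c} \<subseteq>
    fwd_constraints {(r, y, x') | r x'. r \<in> \<Sigma>E \<and> x' \<in> Prev G' r y'} \<union>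
    bwd_constraints {(r, x, y') | r x. r \<in> \<Sigma>E \<and> x \<in> Prev G r y}"
    (is "_ \<subseteq> ?fwd \<union> ?bwd")
proof
  fix c
  assume "c \<in> {c \<in> constraints. (y, y') \<in> snd c}"
  then have "c \<in> constraints" and witness: "(y, y') \<in> snd c"
    by auto
  then consider (fwd) r z x' x where "c = fwd_constraint r x z x'"
      "r \<in> \<Sigma>E" "x' \<in> verts G'" "x \<in> Prev G r z"
    | (bwd) r x z' x' where "c = bwd_constraint r x x' z'"
      "r \<in> \<Sigma>E" "x \<in> verts G" "x' \<in> Prev G' r z'"
    by (auto simp: constraints_def fwd_constraints_def bwd_constraints_def)
  then show "c \<in> ?fwd \<union> ?bwd"
  proof cases
    case fwd
    with witness have "z = y" and "x' \<in> Prev G' r y'"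
      by (auto simp: fwd_constraint_def Prev_def)
    with fwd have "c \<in> ?fwd"
      by (auto simp: fwd_constraints_def)
    then show ?thesis ..
  next
    case bwd
    with witness have "z' = y'" and "x \<in> Prev G r y"
      by (auto simp: bwd_constraint_def Prev_def)
    with bwd have "c \<in> ?bwd"
      by (auto simp: bwd_constraints_def)
    then show ?thesis ..
  qed
qed

lemma prunes_towards_initB:
  assumes "S \<subseteq> candidates"
  shows "prunes_towards S (initB \<Sigma>V \<Sigma>E G G')"
  using assms
  by (auto simp: prunes_towards_def initB_def pruning_inv_def constraints_def candidates_def)

lemma prunes_towards_stepB:
  assumes "stepB \<Sigma>E G G' c c'" and "wf_config c"
    and "consistent constraints S" and "prunes_towards S c"
  shows "prunes_towards S c'"
  using assms
proof (induction rule: stepB.induct)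
  case (ForPP_call r y x' T Z R K)
  with fwd_constraints_remove[OF this(1)] show ?case
    by (simp add: prunes_towards_def Un_assoc)
next
  case (ForPP'_call r x y' T Z R K)
  with bwd_constraints_remove[OF this(1)] show ?case
    by (simp add: prunes_towards_def Un_assoc)
next
  case (PPLoop_move x S' r y d x' Z R K)
  with pending_subset_constraints[of "Z \<union> R" "PPLoop r y x' d S'"] show ?case
    by (auto simp: prunes_towards_def wf_config_def
        intro!: pruning_inv_move[where c = "fwd_constraint r x y x'"])
next
  case (PPLoop'_move x' S' r y' d x Z R K)
  with pending_subset_constraints[of "Z \<union> R" "PPLoop' r x y' d S'"] show ?case
    by (auto simp: prunes_towards_def wf_config_def
        intro!: pruning_inv_move[where c = "bwd_constraint r x x' y'"])
next
  case (PPLoop_skip x S' r y d x' Z R K)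
  then have "(x, x') \<in> Z \<longrightarrow> has_witness (Z \<union> R) (fwd_constraint r x y x')"
    by (auto simp: wf_config_def)
  with PPLoop_skip show ?case
    by (auto simp: prunes_towards_def
        intro: pruning_inv_discharge[where c = "fwd_constraint r x y x'"])
next
  case (PPLoop'_skip x' S' r y' d x Z R K)
  then have "(x, x') \<in> Z \<longrightarrow> has_witness (Z \<union> R) (bwd_constraint r x x' y')"
    by (auto simp: wf_config_def)
  with PPLoop'_skip show ?case
    by (auto simp: prunes_towards_def
        intro: pruning_inv_discharge[where c = "bwd_constraint r x x' y'"])
next
  case (WhileR_iter y y' R Z K)
  then have "y \<in> verts G" "y' \<in> verts G'"
    using candidates_subset by (auto simp: wf_config_def)
  from constraints_witnessed_by_subset[OF this] show ?case
    using WhileR_iter(4) by (auto simp: prunes_towards_def intro!: pruning_inv_extract)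
qed (auto simp: prunes_towards_def fwd_constraints_def bwd_constraints_def)

lemma reachableB_invariants:
  assumes "reachableB \<Sigma>V \<Sigma>E G G' c"
  shows "wf_config c" and "prunes_towards (largest_directed_simulation \<Sigma>V \<Sigma>E G G') c"
proof -
  have largest: "largest_directed_simulation \<Sigma>V \<Sigma>E G G' \<subseteq> candidates"
    "consistent constraints (largest_directed_simulation \<Sigma>V \<Sigma>E G G')"
    using directed_simulation_largest[of \<Sigma>V \<Sigma>E G G']
    by (simp_all add: directed_simulation_iff_consistent)
  have "wf_config c \<and> prunes_towards (largest_directed_simulation \<Sigma>V \<Sigma>E G G') c"
    using assms unfolding reachableB_def
    by (induction rule: rtranclp_induct)
      (auto intro: wf_config_initB wf_config_stepB
        prunes_towards_initB[OF largest(1)] prunes_towards_stepB[OF _ _ largest(2)])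
  then show "wf_config c" and "prunes_towards (largest_directed_simulation \<Sigma>V \<Sigma>E G G') c"
    by auto
qed

lemma reachableB_final:
  assumes "reachableB \<Sigma>V \<Sigma>E G G' (Z, R, [])"
  shows "Z = largest_directed_simulation \<Sigma>V \<Sigma>E G G'"
proof
  from reachableB_invariants[OF assms]
  have "R = {}" and "Z \<subseteq> candidates" and "largest_directed_simulation \<Sigma>V \<Sigma>E G G' \<subseteq> Z"
    and inv: "pruning_inv constraints (largest_directed_simulation \<Sigma>V \<Sigma>E G G') Z R {}"
    by (auto simp: wf_config_def prunes_towards_def pruning_inv_def)
  then show "largest_directed_simulation \<Sigma>V \<Sigma>E G G' \<subseteq> Z"
    by simp
  from inv \<open>R = {}\<close> have "consistent constraints Z"
    by (auto intro: pruning_inv_consistent)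
  with \<open>Z \<subseteq> candidates\<close> have "directed_simulation \<Sigma>V \<Sigma>E G G' Z"
    by (simp add: directed_simulation_iff_consistent)
  then show "Z \<subseteq> largest_directed_simulation \<Sigma>V \<Sigma>E G G'"
    by (auto simp: largest_directed_simulation_def)
qed

section \<open>Termination\<close>

text \<open>The number of steps that executing the statement takes, for \<open>WhileR\<close> with \<open>R = {}\<close>.\<close>

fun duration :: "('v, 'w, 'r) stmt \<Rightarrow> nat" where
  "duration (ForPP T) = 1 + (\<Sum>(r, y, x')\<in>T. 2 + card (Prev G r y))"
| "duration (ForPP' T) = 1 + (\<Sum>(r, x, y')\<in>T. 2 + card (Prev G' r y'))"
| "duration (PPLoop r y x' d S) = 1 + card S"
| "duration (PPLoop' r x y' d S) = 1 + card S"
| "duration WhileR = 1"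

lemma stmt_ok_finite:
  "stmt_ok U (ForPP T) \<Longrightarrow> finite T"
  "stmt_ok U (ForPP' T) \<Longrightarrow> finite T"
  "stmt_ok U (PPLoop r y x' d S) \<Longrightarrow> finite S"
  "stmt_ok U (PPLoop' r x y' d S') \<Longrightarrow> finite S'"
  by (auto dest: finite_subset)

definition termination_order :: "(('v, 'w, 'r) config \<times> ('v, 'w, 'r) config) set" where
  "termination_order =
     measures [\<lambda>(Z, R, K). card (Z \<union> R), \<lambda>(Z, R, K). sum_list (map duration K)]"

lemma wf_termination_order: "wf termination_order"
  by (simp add: termination_order_def)

lemma stepB_decreases:
  assumes "stepB \<Sigma>E G G' c c'" and "wf_config c"
  shows "(c', c) \<in> termination_order"
  using assms unfolding termination_order_def
proof (induction rule: stepB.induct)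
  case (ForPP_call r y x' T Z R K)
  then have "finite T"
    by (auto simp: wf_config_def intro: stmt_ok_finite)
  then show ?case
    using ForPP_call(1) by (simp add: sum.remove[of T])
next
  case (ForPP'_call r x y' T Z R K)
  then have "finite T"
    by (auto simp: wf_config_def intro: stmt_ok_finite)
  then show ?case
    using ForPP'_call(1) by (simp add: sum.remove[of T])
next
  case (WhileR_iter y y' R Z K)
  then have "Z \<union> (R - {(y, y')}) \<subset> Z \<union> R" and "finite (Z \<union> R)"
    using finite_candidates by (auto simp: wf_config_def intro: finite_subset)
  then show ?case
    by (simp add: psubset_card_mono)
qed (auto simp: wf_config_def insert_Diff_Un card_gt_0_iff simp del: stmt_ok.simps
    dest!: stmt_ok_finite intro!: diff_less)

lemma stepB_no_infinite_run:
  assumes "wf_config (c 0)" and step: "\<And>n. stepB \<Sigma>E G G' (c n) (c (Suc n))"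
  shows False
proof -
  have "wf_config (c n)" for n
    using assms by (induction n) (auto intro: wf_config_stepB)
  with step have "(c (Suc n), c n) \<in> termination_order" for n
    by (rule stepB_decreases)
  then show False
    using wf_termination_order unfolding wf_iff_no_infinite_down_chain by blast
qed

end

lemma stepB_progress:
  assumes "K \<noteq> []"
  shows "\<exists>c'. stepB \<Sigma>E G G' (Z, R, K) c'"
proof -
  obtain s K' where K_eq: "K = s # K'"
    using assms by (cases K) auto
  show ?thesis
  proof (cases s)
    case (ForPP T)
    then show ?thesis
      unfolding K_eq by (cases "T = {}") (fastforce intro: stepB.intros)+
  next
    case (ForPP' T)
    then show ?thesis
      unfolding K_eq by (cases "T = {}") (fastforce intro: stepB.intros)+
  next
    case (PPLoop r y x' d S)
    then show ?thesis
      unfolding K_eq by (metis ex_in_conv stepB.PPLoop_done stepB.PPLoop_move stepB.PPLoop_skip)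
  next
    case (PPLoop' r x y' d S)
    then show ?thesis
      unfolding K_eq by (metis ex_in_conv stepB.PPLoop'_done stepB.PPLoop'_move stepB.PPLoop'_skip)
  next
    case WhileR
    then show ?thesis
      unfolding K_eq by (cases "R = {}") (fastforce intro: stepB.intros)+
  qed
qed

theorem theorem3:
  fixes \<Sigma>V :: "'a set" and \<Sigma>E :: "'r set"
    and G :: "('v, 'r, 'a) fuzzy_graph" and G' :: "('w, 'r, 'a) fuzzy_graph"
  assumes "finite_fuzzy_graph \<Sigma>V \<Sigma>E G" and "finite_fuzzy_graph \<Sigma>V \<Sigma>E G'"
  shows "\<not> (\<exists>c :: nat \<Rightarrow> ('v, 'w, 'r) config.
            c 0 = initB \<Sigma>V \<Sigma>E G G' \<and> (\<forall>n. stepB \<Sigma>E G G' (c n) (c (Suc n)))) \<and>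
         (\<forall>Z R K. reachableB \<Sigma>V \<Sigma>E G G' (Z, R, K) \<and> (\<nexists>c'. stepB \<Sigma>E G G' (Z, R, K) c') \<longrightarrow>
            K = [] \<and> Z = largest_directed_simulation \<Sigma>V \<Sigma>E G G')"
proof -
  interpret finite_fuzzy_graph_pair \<Sigma>V \<Sigma>E G G'
    using assms by unfold_locales (auto simp: finite_fuzzy_graph_def is_fuzzy_graph_def)
  show ?thesis
  proof (intro conjI notI allI impI; (elim exE conjE)?)
    fix c :: "nat \<Rightarrow> ('v, 'w, 'r) config"
    assume "c 0 = initB \<Sigma>V \<Sigma>E G G'" and "\<forall>n. stepB \<Sigma>E G G' (c n) (c (Suc n))"
    then show False
      using stepB_no_infinite_run[of c] wf_config_initB by simp
  next
    fix Z R K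
    assume reach: "reachableB \<Sigma>V \<Sigma>E G G' (Z, R, K)" and "\<nexists>c'. stepB \<Sigma>E G G' (Z, R, K) c'"
    then show "K = []"
      using stepB_progress by blast
    with reach show "Z = largest_directed_simulation \<Sigma>V \<Sigma>E G G'"
      using reachableB_invariants reachableB_final by blast
  qed
qed

end
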